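(* The program profile $(\mathrm{CIMCIC},\epsilon\mathrm{GFB})$ in the program game version of the Prisoner's Dilemma yields $(C,C)$, for every $\epsilon\in[0,1]$.
   Context: Base game: the Prisoner's Dilemma with actions $C$ (Cooperate) and $D$ (Defect). Program game: each of two players submits a program. Each program takes as input the source code of the opponent's program, has access to its own source code, and outputs, possibly stochastically, an element of $\{C,D\}$. Non-halting is mapped to the default output $D$. Write $p(q)$ for the (random) output of $p$ when the opponent program is $q$. The profile $(p,q)$ yields $(C,C)$ if $p(q)=C$ and $q(p)=C$, each with probability 1. Idealizations: programs may contain tests of (unbounded) provability in Peano arithmetic $\mathrm{PA}$. Such a test succeeds exactly when a proof exists. Stochastic programs use an infinite sequence of independent uniformly random bits (with fresh bits when one program runs another). Statements about program outputs are expressed as arithmetical sentences by a natural formalization for which $\mathrm{PA}$ verifies the defining clauses of the programs below. For a stochastic program, "$p(q)=C$" means that $p$ outputs $C$ on input $q$ with probability 1. The parameter $\epsilon$ is a rational number written in the source code. Programs, on opponent program $p$: - $\mathrm{CIMCIC}$ (Cooperate if my cooperation implies cooperation from the opponent): returns $C$ if $\mathrm{PA}\vdash\big(\mathrm{CIMCIC}(p)=C\implies p(\mathrm{CIMCIC})=C\big)$; otherwise returns $D$. - $\epsilon\mathrm{GFB}$ ($\epsilon$-grounded Fair Bot): with probability $\epsilon$ returns $C$; with the remaining probability runs $p$ on opponent program $\epsilon\mathrm{GFB}$ and returns the output $p(\epsilon\mathrm{GFB})$. *)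

theory Defs
  imports "HOL-Probability.SPMF" "HOL-Library.Nat_Bijection"
begin

section \<open>Peano arithmetic\<close>

text \<open>First-order formulas over \<open>0, S, +, *, =\<close> with de Bruijn indices: \<open>All A\<close> binds index 0 of
  \<open>A\<close>.\<close>

datatype tm = Var nat | Zero | Succ tm | Add tm tm | Mul tm tm

datatype fm = Eq tm tm | Fls | Imp fm fm | All fm

definition Neg :: "fm \<Rightarrow> fm" where "Neg A = Imp A Fls"

definition Iff :: "fm \<Rightarrow> fm \<Rightarrow> fm" where "Iff A B = Neg (Imp (Imp A B) (Neg (Imp B A)))"

primrec num :: "nat \<Rightarrow> tm" where
  "num 0 = Zero"
| "num (Suc n) = Succ (num n)"

primrec subst_tm :: "(nat \<Rightarrow> tm) \<Rightarrow> tm \<Rightarrow> tm" where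
  "subst_tm \<sigma> (Var i) = \<sigma> i"
| "subst_tm \<sigma> Zero = Zero"
| "subst_tm \<sigma> (Succ t) = Succ (subst_tm \<sigma> t)"
| "subst_tm \<sigma> (Add t u) = Add (subst_tm \<sigma> t) (subst_tm \<sigma> u)"
| "subst_tm \<sigma> (Mul t u) = Mul (subst_tm \<sigma> t) (subst_tm \<sigma> u)"

abbreviation shift :: "tm \<Rightarrow> tm" where "shift \<equiv> subst_tm (\<lambda>i. Var (Suc i))"

primrec subst :: "(nat \<Rightarrow> tm) \<Rightarrow> fm \<Rightarrow> fm" where
  "subst \<sigma> (Eq t u) = Eq (subst_tm \<sigma> t) (subst_tm \<sigma> u)"
| "subst \<sigma> Fls = Fls"
| "subst \<sigma> (Imp A B) = Imp (subst \<sigma> A) (subst \<sigma> B)"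
| "subst \<sigma> (All A) = All (subst (case_nat (Var 0) (\<lambda>i. shift (\<sigma> i))) A)"

definition inst :: "tm list \<Rightarrow> fm \<Rightarrow> fm" where
  "inst ts = subst (\<lambda>i. if i < length ts then ts ! i else Var (i - length ts))"

text \<open>\<open>vars_below k A\<close>: all free indices of \<open>A\<close> are less than \<open>k\<close>.\<close>

primrec tm_vars_below :: "nat \<Rightarrow> tm \<Rightarrow> bool" where
  "tm_vars_below k (Var i) = (i < k)"
| "tm_vars_below k Zero = True"
| "tm_vars_below k (Succ t) = tm_vars_below k t"
| "tm_vars_below k (Add t u) = (tm_vars_below k t \<and> tm_vars_below k u)"
| "tm_vars_below k (Mul t u) = (tm_vars_below k t \<and> tm_vars_below k u)"

primrec vars_below :: "nat \<Rightarrow> fm \<Rightarrow> bool" where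
  "vars_below k (Eq t u) = (tm_vars_below k t \<and> tm_vars_below k u)"
| "vars_below k Fls = True"
| "vars_below k (Imp A B) = (vars_below k A \<and> vars_below k B)"
| "vars_below k (All A) = vars_below (Suc k) A"

text \<open>The standard model.\<close>

primrec val :: "(nat \<Rightarrow> nat) \<Rightarrow> tm \<Rightarrow> nat" where
  "val e (Var i) = e i"
| "val e Zero = 0"
| "val e (Succ t) = Suc (val e t)"
| "val e (Add t u) = val e t + val e u"
| "val e (Mul t u) = val e t * val e u"

primrec sat :: "(nat \<Rightarrow> nat) \<Rightarrow> fm \<Rightarrow> bool" where
  "sat e (Eq t u) = (val e t = val e u)"
| "sat e Fls = False"
| "sat e (Imp A B) = (sat e A \<longrightarrow> sat e B)"
| "sat e (All A) = (\<forall>n. sat (case_nat n e) A)"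

definition true_in_N :: "fm \<Rightarrow> bool" where "true_in_N A \<longleftrightarrow> (\<forall>e. sat e A)"

text \<open>A Hilbert calculus with equality. Free variables are read universally, so the axioms are
  given for open terms and \<open>Gen\<close> binds index 0.\<close>

inductive PA_proves :: "fm \<Rightarrow> bool" ("PA \<turnstile> _" [50] 50) where
  K: "PA \<turnstile> Imp A (Imp B A)"
| S: "PA \<turnstile> Imp (Imp A (Imp B C)) (Imp (Imp A B) (Imp A C))"
| DN: "PA \<turnstile> Imp (Neg (Neg A)) A"
| Spec: "PA \<turnstile> Imp (All A) (inst [t] A)"
| Distr: "PA \<turnstile> Imp (All (Imp (subst (\<lambda>i. Var (Suc i)) A) B)) (Imp A (All B))"
| Refl: "PA \<turnstile> Eq t t"
| Leibniz: "PA \<turnstile> Imp (Eq t u) (Imp (inst [t] A) (inst [u] A))"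
| Succ_not_Zero: "PA \<turnstile> Neg (Eq (Succ t) Zero)"
| Succ_inject: "PA \<turnstile> Imp (Eq (Succ t) (Succ u)) (Eq t u)"
| Add_Zero: "PA \<turnstile> Eq (Add t Zero) t"
| Add_Succ: "PA \<turnstile> Eq (Add t (Succ u)) (Succ (Add t u))"
| Mul_Zero: "PA \<turnstile> Eq (Mul t Zero) Zero"
| Mul_Succ: "PA \<turnstile> Eq (Mul t (Succ u)) (Add (Mul t u) t)"
| Induct: "PA \<turnstile> Imp (inst [Zero] A)
     (Imp (All (Imp A (subst (case_nat (Succ (Var 0)) (\<lambda>i. Var (Suc i))) A))) (All A))"
| MP: "PA \<turnstile> Imp A B \<Longrightarrow> PA \<turnstile> A \<Longrightarrow> PA \<turnstile> B"
| Gen: "PA \<turnstile> A \<Longrightarrow> PA \<turnstile> All A"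

primrec code_tm :: "tm \<Rightarrow> nat" where
  "code_tm (Var i) = prod_encode (0, i)"
| "code_tm Zero = prod_encode (1, 0)"
| "code_tm (Succ t) = prod_encode (2, code_tm t)"
| "code_tm (Add t u) = prod_encode (3, prod_encode (code_tm t, code_tm u))"
| "code_tm (Mul t u) = prod_encode (4, prod_encode (code_tm t, code_tm u))"

primrec code_fm :: "fm \<Rightarrow> nat" where
  "code_fm (Eq t u) = prod_encode (0, prod_encode (code_tm t, code_tm u))"
| "code_fm Fls = prod_encode (1, 0)"
| "code_fm (Imp A B) = prod_encode (2, prod_encode (code_fm A, code_fm B))"
| "code_fm (All A) = prod_encode (3, code_fm A)"

section \<open>Programs\<close>

text \<open>An imperative language on registers holding natural numbers. \<open>Toss x r\<close> stores in register
  \<open>x\<close> the outcome of a fresh coin with success probability \<open>r\<close> (the distribution of comparing a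
  uniform real, read off fresh random bits, with \<open>r\<close>). \<open>Prove x A\<close> tests whether PA proves the
  sentence obtained from \<open>A\<close> by replacing every free variable \<open>i\<close> by the numeral of the content of
  register \<open>i\<close>. \<open>Run x e1 e2\<close> runs the program with source code \<open>e1\<close> on opponent \<open>e2\<close>.\<close>

datatype exp = Const nat | Reg nat | Plus exp exp | Minus exp exp | Times exp exp

datatype com =
    Skip
  | Assign nat exp
  | Seq com com
  | Cond exp com com
  | While exp com
  | Toss nat rat
  | Prove nat fm
  | Run nat exp exp

primrec aval :: "exp \<Rightarrow> (nat \<Rightarrow> nat) \<Rightarrow> nat" where
  "aval (Const n) s = n"
| "aval (Reg x) s = s x"
| "aval (Plus a b) s = aval a s + aval b s"
| "aval (Minus a b) s = aval a s - aval b s"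
| "aval (Times a b) s = aval a s * aval b s"

primrec code_exp :: "exp \<Rightarrow> nat" where
  "code_exp (Const n) = prod_encode (0, n)"
| "code_exp (Reg x) = prod_encode (1, x)"
| "code_exp (Plus a b) = prod_encode (2, prod_encode (code_exp a, code_exp b))"
| "code_exp (Minus a b) = prod_encode (3, prod_encode (code_exp a, code_exp b))"
| "code_exp (Times a b) = prod_encode (4, prod_encode (code_exp a, code_exp b))"

definition code_rat :: "rat \<Rightarrow> nat" where
  "code_rat r = prod_encode (int_encode (fst (quotient_of r)), int_encode (snd (quotient_of r)))"

primrec source :: "com \<Rightarrow> nat" where
  "source Skip = prod_encode (0, 0)"
| "source (Assign x a) = prod_encode (1, prod_encode (x, code_exp a))"
| "source (Seq c d) = prod_encode (2, prod_encode (source c, source d))"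
| "source (Cond a c d) = prod_encode (3, prod_encode (code_exp a, prod_encode (source c, source d)))"
| "source (While a c) = prod_encode (4, prod_encode (code_exp a, source c))"
| "source (Toss x r) = prod_encode (5, prod_encode (x, code_rat r))"
| "source (Prove x A) = prod_encode (6, prod_encode (x, code_fm A))"
| "source (Run x a b) = prod_encode (7, prod_encode (x, prod_encode (code_exp a, code_exp b)))"

lemma code_tm_inject [simp]: "code_tm t = code_tm u \<longleftrightarrow> t = u"
proof (induction t arbitrary: u)
qed (case_tac u; auto)+

lemma code_fm_inject [simp]: "code_fm A = code_fm B \<longleftrightarrow> A = B"
proof (induction A arbitrary: B)
qed (case_tac B; auto)+

lemma code_exp_inject [simp]: "code_exp a = code_exp b \<longleftrightarrow> a = b"
proof (induction a arbitrary: b)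
qed (case_tac b; auto)+

lemma code_rat_inject [simp]: "code_rat r = code_rat q \<longleftrightarrow> r = q"
  by (auto simp: code_rat_def prod_eq_iff int_encode_eq intro: quotient_of_inject)

lemma source_inject [simp]: "source c = source d \<longleftrightarrow> c = d"
proof (induction c arbitrary: d)
qed (case_tac d; auto)+

text \<open>A program starts with its own source code in register 0 and that of the opponent in
  register 1. Register 2 holds the output, where 1 stands for \<open>C\<close> and any other value for \<open>D\<close>.\<close>

abbreviation (input) self :: nat where "self \<equiv> 0"
abbreviation (input) opp :: nat where "opp \<equiv> 1"
abbreviation (input) out :: nat where "out \<equiv> 2"

definition init :: "nat \<Rightarrow> nat \<Rightarrow> nat \<Rightarrow> nat" where
  "init m n = (\<lambda>_. 0)(self := m, opp := n)"

partial_function (spmf) exec :: "com \<Rightarrow> (nat \<Rightarrow> nat) \<Rightarrow> (nat \<Rightarrow> nat) spmf" where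
  "exec c s = (case c of
      Skip \<Rightarrow> return_spmf s
    | Assign x a \<Rightarrow> return_spmf (s(x := aval a s))
    | Seq c1 c2 \<Rightarrow> bind_spmf (exec c1 s) (exec c2)
    | Cond a c1 c2 \<Rightarrow> if aval a s \<noteq> 0 then exec c1 s else exec c2 s
    | While a c1 \<Rightarrow>
        if aval a s \<noteq> 0 then bind_spmf (exec c1 s) (exec (While a c1)) else return_spmf s
    | Toss x r \<Rightarrow>
        spmf_of_pmf (map_pmf (\<lambda>b. s(x := of_bool b)) (bernoulli_pmf (of_rat r)))
    | Prove x A \<Rightarrow> return_spmf (s(x := of_bool (PA \<turnstile> subst (\<lambda>i. num (s i)) A)))
    | Run x a b \<Rightarrow>
        if aval a s \<in> range source
        then bind_spmf (exec (inv source (aval a s)) (init (aval a s) (aval b s)))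
               (\<lambda>s'. return_spmf (s(x := of_bool (s' out = 1))))
        else return_pmf None)"

section \<open>The program game\<close>

datatype action = C | D

text \<open>\<open>None\<close> is non-halting.\<close>

definition play :: "com \<Rightarrow> com \<Rightarrow> action pmf" where
  "play p q = map_pmf
     (\<lambda>r. case r of Some s \<Rightarrow> if s out = 1 then C else D | None \<Rightarrow> D)
     (exec p (init (source p) (source q)))"

definition outputs_C :: "com \<Rightarrow> com \<Rightarrow> bool" where
  "outputs_C p q \<longleftrightarrow> pmf (play p q) C = 1"

definition yields_CC :: "com \<Rightarrow> com \<Rightarrow> bool" where
  "yields_CC p q \<longleftrightarrow> outputs_C p q \<and> outputs_C q p"

section \<open>Arithmetical sentences about outputs\<close>

text \<open>A formula \<open>P\<close> in four free variables is to express ``the program with code \<open>v\<^sub>0\<close> outputs \<open>C\<close> on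
  the opponent with code \<open>v\<^sub>1\<close> with probability at least \<open>v\<^sub>2 / v\<^sub>3\<close>''.\<close>

definition prob_ge :: "fm \<Rightarrow> tm \<Rightarrow> tm \<Rightarrow> rat \<Rightarrow> fm" where
  "prob_ge P x y t =
     inst [x, y, num (nat (fst (quotient_of t))), num (nat (snd (quotient_of t)))] P"

definition coop :: "fm \<Rightarrow> tm \<Rightarrow> tm \<Rightarrow> fm" where
  "coop P x y = prob_ge P x y 1"

abbreviation quot :: "com \<Rightarrow> tm" where "quot p \<equiv> num (source p)"

definition CIMCIC :: "fm \<Rightarrow> com" where
  "CIMCIC P =
     Seq (Prove 3 (Imp (coop P (Var self) (Var opp)) (coop P (Var opp) (Var self))))
         (Cond (Reg 3) (Assign out (Const 1)) (Assign out (Const 0)))"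

definition GFB :: "rat \<Rightarrow> com" where
  "GFB \<epsilon> =
     Seq (Toss 3 \<epsilon>)
         (Cond (Reg 3) (Assign out (Const 1)) (Run out (Reg opp) (Reg self)))"

text \<open>\<open>natural_formalization P Prv\<close>: \<open>P\<close> and \<open>Prv\<close> define output probabilities and PA-provability
  correctly in the standard model, and PA verifies the defining clauses of \<open>CIMCIC\<close> (cooperate with
  probability 1 or 0 according to the test) and of \<open>GFB \<epsilon>\<close> (the probability of output \<open>C\<close> on \<open>p\<close> is
  \<open>\<epsilon> + (1 - \<epsilon>)\<close> times that of \<open>p\<close> on \<open>GFB \<epsilon>\<close>), the probabilities being described by the rational
  thresholds \<open>t\<close> that they reach.\<close>

definition natural_formalization :: "fm \<Rightarrow> fm \<Rightarrow> bool" where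
  "natural_formalization P Prv \<longleftrightarrow>
     vars_below 4 P \<and> vars_below 1 Prv \<and>
     (\<forall>p q t. 0 \<le> t \<longrightarrow>
        (true_in_N (prob_ge P (quot p) (quot q) t) \<longleftrightarrow> of_rat t \<le> pmf (play p q) C)) \<and>
     (\<forall>n. true_in_N (inst [num n] Prv) \<longleftrightarrow> (\<exists>A. n = code_fm A \<and> PA \<turnstile> A)) \<and>
     (\<forall>p t. 0 < t \<and> t \<le> 1 \<longrightarrow>
        PA \<turnstile> Iff (prob_ge P (quot (CIMCIC P)) (quot p) t)
                (inst [num (code_fm (Imp (coop P (quot (CIMCIC P)) (quot p))
                                         (coop P (quot p) (quot (CIMCIC P)))))] Prv)) \<and>
     (\<forall>\<epsilon> p t. 0 \<le> \<epsilon> \<and> \<epsilon> \<le> 1 \<and> 0 \<le> t \<and> t \<le> \<epsilon> \<longrightarrow>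
        PA \<turnstile> prob_ge P (quot (GFB \<epsilon>)) (quot p) t) \<and>
     (\<forall>\<epsilon> p t. 0 \<le> \<epsilon> \<and> \<epsilon> < t \<and> t \<le> 1 \<longrightarrow>
        PA \<turnstile> Iff (prob_ge P (quot (GFB \<epsilon>)) (quot p) t)
                (prob_ge P (quot p) (quot (GFB \<epsilon>)) ((t - \<epsilon>) / (1 - \<epsilon>))))"

end

theory Submission
  imports Defs
begin

text \<open>Let \<open>X\<close> say that CIMCIC cooperates with the grounded Fair Bot and \<open>Y\<close> the converse. The clause
  of the Fair Bot at threshold 1 is that \<open>Y\<close> is equivalent to \<open>X\<close> (for \<open>\<epsilon> < 1\<close>, since
  \<open>(1 - \<epsilon>) / (1 - \<epsilon>) = 1\<close>) or that \<open>Y\<close> is provable (for \<open>\<epsilon> = 1\<close>). Either way PA proves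
  \<open>X \<longrightarrow> Y\<close> without an appeal to Loeb's theorem, so the test of CIMCIC succeeds and CIMCIC
  cooperates; the Fair Bot then cooperates whether it is grounded or copies CIMCIC.\<close>

lemma subst_tm_cong:
  "tm_vars_below k t \<Longrightarrow> (\<And>i. i < k \<Longrightarrow> \<sigma> i = \<tau> i) \<Longrightarrow> subst_tm \<sigma> t = subst_tm \<tau> t"
  by (induction t) auto

lemma subst_cong:
  "vars_below k A \<Longrightarrow> (\<And>i. i < k \<Longrightarrow> \<sigma> i = \<tau> i) \<Longrightarrow> subst \<sigma> A = subst \<tau> A"
proof (induction A arbitrary: k \<sigma> \<tau>)
  case (Eq t u)
  then show ?case
    using subst_tm_cong[of k t \<sigma> \<tau>] subst_tm_cong[of k u \<sigma> \<tau>] by simp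
next
  case (Imp A B)
  from Imp.prems Imp.IH(1)[of k \<sigma> \<tau>] Imp.IH(2)[of k \<sigma> \<tau>] show ?case by simp
next
  case (All A)
  show ?case
    using All.prems by (auto intro!: All.IH[of "Suc k"] split: nat.split)
qed simp

lemma subst_tm_subst_tm: "subst_tm \<sigma> (subst_tm \<tau> t) = subst_tm (\<lambda>i. subst_tm \<sigma> (\<tau> i)) t"
  by (induction t) auto

lemma subst_subst: "subst \<sigma> (subst \<tau> A) = subst (\<lambda>i. subst_tm \<sigma> (\<tau> i)) A"
proof (induction A arbitrary: \<sigma> \<tau>)
  case (All A)
  have "(\<lambda>i. subst_tm (case_nat (Var 0) (\<lambda>i. shift (\<sigma> i))) (case_nat (Var 0) (\<lambda>i. shift (\<tau> i)) i))
    = case_nat (Var 0) (\<lambda>i. shift (subst_tm \<sigma> (\<tau> i)))"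
    by (rule ext) (simp add: subst_tm_subst_tm split: nat.split)
  then show ?case by (simp add: All.IH)
qed (simp_all add: subst_tm_subst_tm)

lemma subst_tm_num [simp]: "subst_tm \<sigma> (num n) = num n"
  by (induction n) auto

lemma subst_inst:
  assumes "vars_below (length ts) A"
  shows "subst \<sigma> (inst ts A) = inst (map (subst_tm \<sigma>) ts) A"
  unfolding inst_def subst_subst by (rule subst_cong[OF assms]) simp

text \<open>The test of \<open>CIMCIC\<close> substitutes register contents for
  \<open>Var self\<close> and \<open>Var opp\<close>. The free indices of \<open>P\<close> lie below
  4 and \<open>prob_ge\<close> fills all four, so the test becomes the sentence about the quoted
  programs.\<close>

lemma subst_coop:
  assumes "vars_below 4 P"
  shows "subst \<sigma> (coop P x y) = coop P (subst_tm \<sigma> x) (subst_tm \<sigma> y)"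
  using assms by (simp add: coop_def prob_ge_def subst_inst eval_nat_numeral)

lemma PA_Imp_const: "PA \<turnstile> B \<Longrightarrow> PA \<turnstile> Imp A B"
  by (rule MP[OF K])

lemma PA_Imp_trans: "PA \<turnstile> Imp A B \<Longrightarrow> PA \<turnstile> Imp B E \<Longrightarrow> PA \<turnstile> Imp A E"
  by (blast intro: MP S PA_Imp_const)

lemma PA_Iff_D2:
  assumes "PA \<turnstile> Iff A B"
  shows "PA \<turnstile> Imp B A"
proof -
  \<comment> \<open>By \<open>K\<close>, \<open>Neg (Imp B A)\<close> implies
    \<open>Imp (Imp A B) (Neg (Imp B A))\<close>, which \<open>Iff A B\<close> refutes.\<close>
  have "PA \<turnstile> Imp (Neg (Imp B A)) Fls"
    using assms PA_Imp_trans[OF K] unfolding Iff_def Neg_def by blast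
  then show ?thesis
    using MP[OF DN] by (simp add: Neg_def)
qed

text \<open>Probability 1 means that the whole support maps to \<open>C\<close>; \<open>None\<close>
  counts as \<open>D\<close>, so it must not occur there.\<close>

lemma outputs_C_iff:
  "outputs_C p q \<longleftrightarrow>
     (\<forall>r \<in> set_pmf (exec p (init (source p) (source q))). \<exists>s. r = Some s \<and> s out = 1)"
proof -
  have "outputs_C p q \<longleftrightarrow> set_pmf (play p q) \<subseteq> {C}"
    by (auto simp: outputs_C_def pmf.rep_eq measure_pmf.prob_eq_1 AE_measure_pmf_iff)
  also have "\<dots> \<longleftrightarrow>
      (\<forall>r \<in> set_pmf (exec p (init (source p) (source q))). \<exists>s. r = Some s \<and> s out = 1)"
    by (auto simp: play_def split: option.splits if_splits)
  finally show ?thesis .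
qed

text \<open>Fixing the constructor keeps the simplifier from unfolding \<open>exec\<close>
  forever.\<close>

lemmas exec_unfold =
  exec.simps[of "Assign x a" for x a, simplified]
  exec.simps[of "Seq c d" for c d, simplified]
  exec.simps[of "Cond a c d" for a c d, simplified]
  exec.simps[of "Toss x r" for x r, simplified]
  exec.simps[of "Prove x A" for x A, simplified]
  exec.simps[of "Run x a b" for x a b, simplified]

lemma outputs_C_CIMCIC:
  assumes "vars_below 4 P"
    and "PA \<turnstile> Imp (coop P (quot (CIMCIC P)) (quot q)) (coop P (quot q) (quot (CIMCIC P)))"
  shows "outputs_C (CIMCIC P) q"
proof -
  let ?s = "init (source (CIMCIC P)) (source q)"
  have "exec (CIMCIC P) ?s = return_spmf (?s(3 := 1, out := 1))"
    \<comment> \<open>Unfolds the program only as an argument of \<open>exec\<close>;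
      \<open>source (CIMCIC P)\<close> stays folded, as in the assumption.\<close>
    unfolding CIMCIC_def[of P, THEN arg_cong[where f = exec]]
    using assms by (simp add: exec_unfold subst_coop init_def)
  then show ?thesis
    by (simp add: outputs_C_iff)
qed

lemma outputs_C_GFB:
  assumes "outputs_C q (GFB \<epsilon>)"
  shows "outputs_C (GFB \<epsilon>) q"
proof -
  let ?s = "init (source (GFB \<epsilon>)) (source q)"
  have inv: "inv source (source q) = q"
    by (simp add: inj_on_def)
  \<comment> \<open>The support now splits by the coin: success outputs 1 at once, failure copies
    the output of \<open>q\<close>, which is 1 on its whole support by assumption.\<close>
  have "exec (GFB \<epsilon>) ?s = bernoulli_pmf (of_rat \<epsilon>) \<bind> (\<lambda>b.
      if b then return_spmf (?s(3 := 1, out := 1))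
      else exec q (init (source q) (source (GFB \<epsilon>))) \<bind>
        (\<lambda>r. case r of None \<Rightarrow> return_pmf None
          | Some s' \<Rightarrow> return_spmf (?s(3 := 0, out := of_bool (s' out = 1)))))"
    unfolding GFB_def[of \<epsilon>, THEN arg_cong[where f = exec]]
    by (auto simp: exec_unfold bind_spmf_def spmf_of_pmf_def map_pmf_def bind_assoc_pmf
        bind_return_pmf init_def inv intro!: bind_pmf_cong split: option.split)
  then show ?thesis
    using assms by (auto simp: outputs_C_iff split: if_splits option.splits)
qed

theorem proposition9:
  fixes P Prv :: fm and \<epsilon> :: rat
  assumes "natural_formalization P Prv"
    and "0 \<le> \<epsilon>" and "\<epsilon> \<le> 1"
  shows "yields_CC (CIMCIC P) (GFB \<epsilon>)"
proof -
  let ?X = "coop P (quot (CIMCIC P)) (quot (GFB \<epsilon>))"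
  let ?Y = "coop P (quot (GFB \<epsilon>)) (quot (CIMCIC P))"
  have vars: "vars_below 4 P"
    using assms(1) by (simp add: natural_formalization_def)
  have "PA \<turnstile> Imp ?X ?Y"
  proof (cases "\<epsilon> = 1")
    case True
    then have "PA \<turnstile> ?Y"
      using assms(1) unfolding natural_formalization_def coop_def by simp
    then show ?thesis by (rule PA_Imp_const)
  next
    case False
    then have "\<epsilon> < 1" using assms(3) by simp
    \<comment> \<open>The clause at \<open>t = 1\<close>, with the quotient left unevaluated so that
      it matches syntactically.\<close>
    then have "PA \<turnstile> Iff ?Y (prob_ge P (quot (CIMCIC P)) (quot (GFB \<epsilon>)) ((1 - \<epsilon>) / (1 - \<epsilon>)))"
      using assms(1,2) unfolding natural_formalization_def coop_def by blast
    then have "PA \<turnstile> Iff ?Y ?X"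
      using False by (simp add: coop_def)
    then show ?thesis by (rule PA_Iff_D2)
  qed
  then have "outputs_C (CIMCIC P) (GFB \<epsilon>)"
    by (rule outputs_C_CIMCIC[OF vars])
  then show ?thesis
    by (simp add: yields_CC_def outputs_C_GFB)
qed

end
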